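(* Let $\mathcal{I}$ be a finite index set, let $\{S_i\}_{i\in\mathcal{I}}$ be an iterated function system of similarities on a compact subset of $\mathbb{R}^d$ with similarity ratios $c_i\in(0,1)$, let $\{p_i\}_{i\in\mathcal{I}}$ be probabilities with $p_i>0$ for all $i$ and $\sum_{i\in\mathcal{I}}p_i=1$, and let $\mu$ be the associated self-similar measure. Assume that the strong separation condition is satisfied. Then \[ \overline{\dim}_{\mathrm{reg}}\,\mu\ =\ \sup_{x\in\mathrm{supp}(\mu)}\overline{\dim}_{\mathrm{loc}}(x,\mu)\ =\ T(\mu)\ =\ \max_{i\in\mathcal{I}}\frac{\log p_i}{\log c_i}. \]
   Context: $B(x,r)$ denotes the open ball of centre $x$ and radius $r$, and $\mathrm{supp}(\mu)$ is the support of $\mu$. $S_i$ is a similarity with ratio $c_i$ if $|S_i(x)-S_i(y)|=c_i|x-y|$ for all $x,y$. Each $S_i$ maps a fixed non-empty compact subset of $\mathbb{R}^d$ into itself. The attractor $F$ is the unique non-empty compact set with $F=\bigcup_{i\in\mathcal{I}}S_i(F)$, and the self-similar measure $\mu$ is the unique Borel probability measure with $\mu=\sum_{i\in\mathcal{I}}p_i\,\mu\circ S_i^{-1}$; its support is $F$. The strong separation condition (SSC) means $S_i(F)\cap S_j(F)=\emptyset$ for all distinct $i,j\in\mathcal{I}$. Upper regularity dimension: $\overline{\dim}_{\mathrm{reg}}\,\mu$ is the infimum of all $s\ge 0$ for which there is a constant $C>0$ such that for all $0<r<R$ and all $x\in\mathrm{supp}(\mu)$, $\frac{\mu(B(x,R))}{\mu(B(x,r))}\le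 C\left(\frac{R}{r}\right)^s$ (with $\inf\emptyset=+\infty$). Upper local dimension at $x\in\mathrm{supp}(\mu)$: $\overline{\dim}_{\mathrm{loc}}(x,\mu)=\limsup_{r\to0}\frac{\log\mu(B(x,r))}{\log r}$. (Lower) $L^q$-spectrum: for $q\in\mathbb{R}$ and $r>0$ let \[ M_r^q(\mu)=\sup\Big\{\sum_{i}\mu(B(x_i,r))^q\Big\}, \] the supremum being over all countable (possibly finite) families of points $x_i\in\mathrm{supp}(\mu)$ with $|x_i-x_j|>2r$ for $i\ne j$; then $\underline{\tau}(q)=\liminf_{r\to0}\frac{\log M_r^q(\mu)}{\log r}$. Top of the spectrum: $T(\mu)=\sup\{s\ge0:\ \underline{\tau}(q)<sq\ \text{ for all } q<0\}$, with the convention that the supremum is $0$ if the set is empty. *)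

theory Defs
  imports "HOL-Analysis.Analysis"
begin

definition similarity_on :: "real \<Rightarrow> 'a::metric_space set \<Rightarrow> ('a \<Rightarrow> 'a) \<Rightarrow> bool" where
  "similarity_on c X f \<longleftrightarrow> (\<forall>x\<in>X. \<forall>y\<in>X. dist (f x) (f y) = c * dist x y)"

(* The maps need to be given only on the compact set X; their values outside X never matter. *)
definition similarity_ifs ::
  "'i set \<Rightarrow> 'a::metric_space set \<Rightarrow> ('i \<Rightarrow> 'a \<Rightarrow> 'a) \<Rightarrow> ('i \<Rightarrow> real) \<Rightarrow> bool" where
  "similarity_ifs I X S c \<longleftrightarrow>
     finite I \<and> compact X \<and> X \<noteq> {} \<and>
     (\<forall>i\<in>I. 0 < c i \<and> c i < 1 \<and> S i ` X \<subseteq> X \<and> similarity_on (c i) X (S i))"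

definition is_attractor ::
  "'i set \<Rightarrow> 'a::metric_space set \<Rightarrow> ('i \<Rightarrow> 'a \<Rightarrow> 'a) \<Rightarrow> 'a set \<Rightarrow> bool" where
  "is_attractor I X S F \<longleftrightarrow> F \<subseteq> X \<and> compact F \<and> F \<noteq> {} \<and> F = (\<Union>i\<in>I. S i ` F)"

definition strong_separation :: "'i set \<Rightarrow> ('i \<Rightarrow> 'a \<Rightarrow> 'a) \<Rightarrow> 'a set \<Rightarrow> bool" where
  "strong_separation I S F \<longleftrightarrow> (\<forall>i\<in>I. \<forall>j\<in>I. i \<noteq> j \<longrightarrow> S i ` F \<inter> S j ` F = {})"

definition prob_vector :: "'i set \<Rightarrow> ('i \<Rightarrow> real) \<Rightarrow> bool" where
  "prob_vector I p \<longleftrightarrow> (\<forall>i\<in>I. 0 < p i) \<and> (\<Sum>i\<in>I. p i) = 1"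

(* The preimage under S i, as a map on X, is S i -` A \<inter> X. When p is a probability vector,
   taking A = UNIV shows that M gives X full measure. *)
definition is_self_similar_measure ::
  "'i set \<Rightarrow> 'a::metric_space set \<Rightarrow> ('i \<Rightarrow> 'a \<Rightarrow> 'a) \<Rightarrow> ('i \<Rightarrow> real) \<Rightarrow> 'a measure \<Rightarrow> bool" where
  "is_self_similar_measure I X S p M \<longleftrightarrow>
     sets M = sets borel \<and> emeasure M (space M) = 1 \<and>
     (\<forall>A\<in>sets borel. measure M A = (\<Sum>i\<in>I. p i * measure M (S i -` A \<inter> X)))"

definition msupp :: "'a::metric_space measure \<Rightarrow> 'a set" where
  "msupp M = {x. \<forall>r>0. 0 < emeasure M (ball x r)}"

(* The real-valued measure of balls is used below, so the following notions are meant for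
   finite Borel measures. Dimensions take values in ereal, where Inf {} = \<infinity>. *)
definition upper_reg_dim :: "'a::metric_space measure \<Rightarrow> ereal" where
  "upper_reg_dim M = Inf {ereal s | s. 0 \<le> s \<and>
     (\<exists>C>0. \<forall>r R. \<forall>x\<in>msupp M. 0 < r \<and> r < R \<longrightarrow>
        measure M (ball x R) / measure M (ball x r) \<le> C * (R / r) powr s)}"

definition upper_loc_dim :: "'a::metric_space measure \<Rightarrow> 'a \<Rightarrow> ereal" where
  "upper_loc_dim M x = Limsup (at_right 0) (\<lambda>r. ereal (ln (measure M (ball x r)) / ln r))"

definition ln_extended :: "ennreal \<Rightarrow> ereal" where
  "ln_extended a = (if a = 0 then - \<infinity> else if a = \<infinity> then \<infinity> else ereal (ln (enn2real a)))"

(* A family of points with pairwise distances > 2r is injective, so the families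
   are represented by their sets of values. *)
definition Lq_moment :: "'a::metric_space measure \<Rightarrow> real \<Rightarrow> real \<Rightarrow> ennreal" where
  "Lq_moment M q r =
     (SUP P \<in> {P. countable P \<and> P \<subseteq> msupp M \<and> pairwise (\<lambda>x y. dist x y > 2 * r) P}.
        infsum (\<lambda>x. ennreal (measure M (ball x r) powr q)) P)"

definition lower_Lq_spectrum :: "'a::metric_space measure \<Rightarrow> real \<Rightarrow> ereal" where
  "lower_Lq_spectrum M q =
     Liminf (at_right 0) (\<lambda>r. ln_extended (Lq_moment M q r) / ereal (ln r))"

(* Inserting 0 only matters when no s qualifies: then the supremum is 0 by convention
   (in ereal, Sup {} would be - \<infinity>). *)
definition top_of_spectrum :: "'a::metric_space measure \<Rightarrow> ereal" where
  "top_of_spectrum M =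
     Sup (insert 0 {ereal s | s. 0 \<le> s \<and> (\<forall>q<0. lower_Lq_spectrum M q < ereal (s * q))})"

end

theory Submission
  imports Defs "HOL-Probability.Probability_Measure"
begin

text \<open>
Write \<open>s\<close> for the largest of the numbers \<open>ln (p i) / ln (c i)\<close>. All three quantities equal \<open>s\<close>
because of a cycle of inequalities
\<open>s \<le> sup upper_loc_dim \<le> top_of_spectrum \<le> upper_reg_dim \<le> s\<close>.

The two inner inequalities hold for every probability measure of bounded support. If the upper
local dimension at \<open>x\<close> exceeds \<open>t\<close>, the one-point packing \<open>{x}\<close> alone makes the moment of every
order \<open>q < 0\<close> large at arbitrarily small scales, so the spectrum at \<open>q\<close> is at most \<open>t * q\<close>
(\<open>upper_loc_dim_le_top_of_spectrum\<close>). Conversely, an exponent \<open>t\<close> admissible for the upper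
regularity dimension bounds the mass of every small \<open>r\<close>-ball centred in the support below by a
multiple of \<open>r powr t\<close>. The balls of a packing are disjoint, hence have total mass at most 1; so the
sum of the masses to the power \<open>q\<close> is at most a multiple of \<open>r powr (t * (q - 1))\<close>, the spectrum at
\<open>q\<close> is at least \<open>(q - 1) * t\<close>, and comparing slopes as \<open>q\<close> tends to minus infinity shows that the
top of the spectrum is at most \<open>t\<close> (\<open>top_of_spectrum_le_upper_reg_dim\<close>).

The two outer inequalities come from the renormalisation of balls. For \<open>y\<close> in the attractor \<open>F\<close>,
the ball of radius \<open>r\<close> about \<open>S i y\<close> always has at least \<open>p i\<close> times the mass of the ball of radius
\<open>r / c i\<close> about \<open>y\<close>, with equality as soon as \<open>r\<close> is at most the distance between the pieces of
\<open>F\<close> (\<open>measure_ball_ge\<close>, \<open>measure_ball_eq\<close>). Since \<open>p i \<ge> c i powr s\<close>, zooming in to the scale of the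
whole attractor gives a lower bound of order \<open>r powr s\<close> for the mass of \<open>r\<close>-balls, and since small
concentric balls are rescaled simultaneously, their mass ratio is that of a pair whose larger radius
is bounded below; hence \<open>upper_reg_dim \<le> s\<close>. For the reverse, take \<open>i\<close> with \<open>p i = c i powr s\<close>:
around the fixed point of \<open>S i\<close> in \<open>F\<close> the renormalisation can be iterated with this \<open>i\<close> only, so that the
mass of the \<open>r\<close>-balls about it is at most a multiple of \<open>r powr s\<close>.
\<close>

section \<open>Logarithmic exponents\<close>

lemma ln_extended_le:
  assumes "a \<le> ennreal b" "0 < b"
  shows "ln_extended a \<le> ereal (ln b)"
proof (cases "a = 0")
  case True
  then show ?thesis by (simp add: ln_extended_def)
next
  case False
  have fin: "a \<noteq> \<infinity>"
    using assms(1) by (auto simp: top_unique)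
  have "enn2real a \<le> b"
    using assms by (simp add: enn2real_leI)
  moreover have "0 < enn2real a"
    using False fin by (simp add: enn2real_positive_iff less_top zero_less_iff_neq_zero)
  ultimately show ?thesis
    using False fin by (simp add: ln_extended_def)
qed

lemma ln_extended_ge:
  assumes "ennreal b \<le> a" "0 < b"
  shows "ereal (ln b) \<le> ln_extended a"
proof (cases "a = \<infinity>")
  case True
  then show ?thesis by (simp add: ln_extended_def)
next
  case False
  have "a \<noteq> 0"
    using assms by (auto simp: ennreal_eq_0_iff)
  moreover have "b \<le> enn2real a"
    using assms False by (metis enn2real_ennreal enn2real_mono infinity_ennreal_def less_eq_real_def less_top)
  ultimately show ?thesis
    using assms(2) False by (simp add: ln_extended_def)
qed

text \<open>
Multiplicative constants do not influence logarithmic exponents: through this limit, power laws for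
the mass of balls become bounds on dimensions.
\<close>
lemma tendsto_log_of_power_law:
  fixes K s :: real
  assumes "0 < K"
  shows "((\<lambda>r. ln (K * r powr s) / ln r) \<longlongrightarrow> s) (at_right 0)"
proof -
  have "((\<lambda>r. ln K / ln r + s) \<longlongrightarrow> 0 + s) (at_right 0)"
    by (intro tendsto_add tendsto_const tendsto_divide_0[OF tendsto_const]
          filterlim_at_bot_imp_at_infinity ln_at_0)
  moreover have "\<forall>\<^sub>F r in at_right 0. ln K / ln r + s = ln (K * r powr s) / ln r"
    using eventually_at_right_real[of 0 1]
  proof (rule eventually_mono)
    show "(0::real) < 1" by simp
    fix r :: real assume "r \<in> {0<..<1}"
    then have "0 < r" "r < 1" "ln r < 0" by auto
    then show "ln K / ln r + s = ln (K * r powr s) / ln r"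
      using assms by (simp add: ln_mult ln_powr add_divide_distrib)
  qed
  ultimately show ?thesis
    by (auto intro: Lim_transform_eventually)
qed

section \<open>Inequalities between the dimensions of a probability measure\<close>

lemma measure_ball_pos:
  assumes "prob_space M" "x \<in> msupp M" "0 < r"
  shows "0 < measure M (ball x r)"
proof -
  interpret prob_space M by fact
  show ?thesis
    using assms(2,3) by (auto simp: msupp_def emeasure_eq_measure)
qed

lemma Lq_moment_ge:
  assumes "x \<in> msupp M"
  shows "ennreal (measure M (ball x r) powr q) \<le> Lq_moment M q r"
  unfolding Lq_moment_def
  by (rule SUP_upper2[of "{x}"]) (use assms in auto)

text \<open>
In a packing, one factor of each \<open>q\<close>-th power is spent on disjointness (total mass at most 1), and
the remaining power \<open>q - 1\<close> is bounded through the smallest mass \<open>b\<close>. In this way the number of points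
of a packing never has to be counted.
\<close>
lemma Lq_moment_le:
  fixes M :: "'a::metric_space measure"
  assumes "prob_space M" and borel: "sets M = sets borel"
    and "q \<le> 1" "0 < b"
    and lower: "\<And>x. x \<in> msupp M \<Longrightarrow> b \<le> measure M (ball x r)"
  shows "Lq_moment M q r \<le> ennreal (b powr (q - 1))"
  unfolding Lq_moment_def
proof (rule SUP_least)
  interpret prob_space M by fact
  fix P :: "'a set"
  assume "P \<in> {P. countable P \<and> P \<subseteq> msupp M \<and> pairwise (\<lambda>x y. dist x y > 2 * r) P}"
  then have P: "P \<subseteq> msupp M" "pairwise (\<lambda>x y. dist x y > 2 * r) P"
    by auto
  have "(\<Sum>x\<in>Q. ennreal (prob (ball x r) powr q)) \<le> ennreal (b powr (q - 1))"
    if Q: "finite Q" "Q \<subseteq> P" for Q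
  proof -
    have "disjoint_family_on (\<lambda>x. ball x r) Q"
      unfolding disjoint_family_on_def
    proof (intro ballI impI)
      fix x y assume "x \<in> Q" "y \<in> Q" "x \<noteq> y"
      then have "dist x y > 2 * r"
        using P Q by (auto simp: pairwise_def)
      then show "ball x r \<inter> ball y r = {}"
        by (intro disjoint_ballI) auto
    qed
    then have "(\<Sum>x\<in>Q. prob (ball x r)) = prob (\<Union>x\<in>Q. ball x r)"
      using Q borel by (intro finite_measure_finite_Union[symmetric]) auto
    then have le1: "(\<Sum>x\<in>Q. prob (ball x r)) \<le> 1"
      by simp
    have "(\<Sum>x\<in>Q. prob (ball x r) powr q) \<le> (\<Sum>x\<in>Q. prob (ball x r) * b powr (q - 1))"
    proof (rule sum_mono)
      fix x assume "x \<in> Q"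
      then have b: "b \<le> prob (ball x r)"
        using P Q lower by auto
      then have "prob (ball x r) powr q = prob (ball x r) * prob (ball x r) powr (q - 1)"
        using \<open>0 < b\<close> by (simp add: powr_mult_base)
      also have "\<dots> \<le> prob (ball x r) * b powr (q - 1)"
        using b \<open>0 < b\<close> \<open>q \<le> 1\<close> by (intro mult_left_mono powr_mono2') auto
      finally show "prob (ball x r) powr q \<le> prob (ball x r) * b powr (q - 1)" .
    qed
    also have "\<dots> = (\<Sum>x\<in>Q. prob (ball x r)) * b powr (q - 1)"
      by (simp add: sum_distrib_right)
    also have "\<dots> \<le> b powr (q - 1)"
      using mult_right_mono[OF le1, of "b powr (q - 1)"] by simp
    finally show ?thesis
      by (simp add: sum_ennreal ennreal_leI)
  qed
  \<comment> \<open>A sum of nonnegative terms is the supremum of its finite partial sums.\<close>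
  then show "(\<Sum>\<^sub>\<infinity>x\<in>P. ennreal (prob (ball x r) powr q)) \<le> ennreal (b powr (q - 1))"
    by (subst nonneg_infsum_complete) (auto intro!: SUP_least)
qed

text \<open>
The bound is the logarithmic form of \<open>Lq_moment_le\<close>. The offset \<open>- s\<close> from the line \<open>q * s\<close> is the
price of the packing; it is harmless for slopes as \<open>q\<close> tends to minus infinity.
\<close>
lemma lower_Lq_spectrum_ge:
  fixes M :: "'a::metric_space measure"
  assumes "prob_space M" "sets M = sets borel" "q < 0" "0 < K"
    and lower: "\<forall>\<^sub>F r in at_right 0. \<forall>x\<in>msupp M. K * r powr s \<le> measure M (ball x r)"
  shows "ereal ((q - 1) * s) \<le> lower_Lq_spectrum M q"
proof -
  let ?h = "\<lambda>r. ereal ((q - 1) * (ln (K * r powr s) / ln r))"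
  have "(?h \<longlongrightarrow> ereal ((q - 1) * s)) (at_right 0)"
    by (intro tendsto_ereal tendsto_mult_left tendsto_log_of_power_law \<open>0 < K\<close>)
  then have "ereal ((q - 1) * s) = Liminf (at_right 0) ?h"
    by (intro lim_imp_Liminf[symmetric]) auto
  also have "\<dots> \<le> lower_Lq_spectrum M q"
    unfolding lower_Lq_spectrum_def
  proof (rule Liminf_mono, use lower eventually_at_right_real[of 0 1, simplified] in eventually_elim)
    case (elim r)
    then have r: "0 < r" "ln r < 0" by auto
    have pos: "0 < K * r powr s" using r \<open>0 < K\<close> by simp
    have "ln_extended (Lq_moment M q r) \<le> ereal (ln ((K * r powr s) powr (q - 1)))"
      using elim pos assms by (intro ln_extended_le Lq_moment_le) auto
    then have "ln_extended (Lq_moment M q r) \<le> ereal (ln r) * ?h r"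
      using r pos by (simp add: ln_powr)
    then show ?case
      using r by (subst ereal_le_divide_neg) auto
  qed
  finally show ?thesis .
qed

text \<open>
If the spectrum exceeded \<open>t * q\<close>, the moments would be too small at all small scales, and comparing
with the packing \<open>{x}\<close> would give \<open>ln (\<mu> (B(x, r))) / ln r \<le> t\<close> at all these scales. Both \<open>ln r\<close> and
\<open>q\<close> are negative, so the inequality is reversed twice.
\<close>
lemma lower_Lq_spectrum_le_if_upper_loc_dim_gt:
  fixes M :: "'a::metric_space measure"
  assumes "prob_space M" "x \<in> msupp M" "q < 0" and t: "ereal t < upper_loc_dim M x"
  shows "lower_Lq_spectrum M q \<le> ereal (t * q)"
proof (rule ccontr)
  assume "\<not> ?thesis"
  then have "\<forall>\<^sub>F r in at_right 0. ereal (t * q) < ln_extended (Lq_moment M q r) / ereal (ln r)"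
    unfolding lower_Lq_spectrum_def by (intro less_LiminfD) simp
  then have "\<forall>\<^sub>F r in at_right 0. ereal (ln (measure M (ball x r)) / ln r) \<le> ereal t"
    using eventually_at_right_real[of 0 1, simplified]
  proof eventually_elim
    case (elim r)
    then have r: "0 < r" "ln r < 0" by auto
    let ?m = "measure M (ball x r)"
    have m: "0 < ?m" using assms r by (simp add: measure_ball_pos)
    then have "ereal (q * ln ?m) \<le> ln_extended (Lq_moment M q r)"
      using ln_extended_ge[OF Lq_moment_ge[OF \<open>x \<in> msupp M\<close>]] by (simp add: ln_powr)
    then have "ln_extended (Lq_moment M q r) / ereal (ln r) \<le> ereal (q * ln ?m / ln r)"
      using r by (subst ereal_divide_le_neg) (auto simp: mult.commute)
    with elim(1) have "ereal (t * q) < ereal (q * ln ?m / ln r)"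
      by (rule less_le_trans)
    then have "q * t < q * (ln ?m / ln r)"
      by (simp add: mult.commute)
    then show ?case
      unfolding mult_less_cancel_left_neg[OF \<open>q < 0\<close>] by simp
  qed
  then have "upper_loc_dim M x \<le> ereal t"
    unfolding upper_loc_dim_def by (rule Limsup_bounded)
  with t show False by simp
qed

lemma upper_loc_dim_le_top_of_spectrum:
  fixes M :: "'a::metric_space measure"
  assumes "prob_space M" "x \<in> msupp M"
  shows "upper_loc_dim M x \<le> top_of_spectrum M"
proof (rule dense_le)
  fix y assume y: "y < upper_loc_dim M x"
  have nonneg: "0 \<le> top_of_spectrum M"
    unfolding top_of_spectrum_def by (rule Sup_upper) simp
  show "y \<le> top_of_spectrum M"
  proof (cases "0 \<le> y")
    case True
    with y obtain s where s: "y = ereal s" "0 \<le> s"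
      by (cases y) auto
    obtain t where t: "s < t" "ereal t < upper_loc_dim M x"
      using ereal_dense2[OF y] s by auto
    have "lower_Lq_spectrum M q < ereal (s * q)" if "q < 0" for q
      using lower_Lq_spectrum_le_if_upper_loc_dim_gt[OF assms that t(2)] t(1) that
      by (auto elim!: le_less_trans)
    then show ?thesis
      unfolding top_of_spectrum_def s(1) using s(2) by (intro Sup_upper) auto
  qed (use nonneg in auto)
qed

text \<open>
The uniform lower bound \<open>\<eta>\<close> at the fixed radius \<open>D\<close> replaces compactness of the support: it turns the
relative bound in the definition of the regularity dimension into an absolute lower bound
\<open>K * r powr s\<close> for the mass of small balls.
\<close>
lemma top_of_spectrum_le_upper_reg_dim:
  fixes M :: "'a::metric_space measure"
  assumes "prob_space M" "sets M = sets borel" "0 < D" "0 < \<eta>"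
    and \<eta>: "\<And>x. x \<in> msupp M \<Longrightarrow> \<eta> \<le> measure M (ball x D)"
  shows "top_of_spectrum M \<le> upper_reg_dim M"
  unfolding upper_reg_dim_def
proof (rule Inf_greatest)
  fix e assume "e \<in> {ereal s |s. 0 \<le> s \<and>
     (\<exists>C>0. \<forall>r R. \<forall>x\<in>msupp M. 0 < r \<and> r < R \<longrightarrow>
        measure M (ball x R) / measure M (ball x r) \<le> C * (R / r) powr s)}"
  then obtain s C where e: "e = ereal s" and "0 \<le> s" "0 < C"
    and C: "\<And>r R x. x \<in> msupp M \<Longrightarrow> 0 < r \<Longrightarrow> r < R \<Longrightarrow>
        measure M (ball x R) / measure M (ball x r) \<le> C * (R / r) powr s"
    by blast
  define K where "K = \<eta> / (C * D powr s)"
  have "0 < K" using assms \<open>0 < C\<close> by (simp add: K_def)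
  have "\<forall>\<^sub>F r in at_right 0. \<forall>x\<in>msupp M. K * r powr s \<le> measure M (ball x r)"
    using eventually_at_right_real[OF \<open>0 < D\<close>]
  proof eventually_elim
    case (elim r)
    then have r: "0 < r" "r < D" by auto
    show ?case
    proof
      fix x assume x: "x \<in> msupp M"
      have m: "0 < measure M (ball x r)" using assms x r by (simp add: measure_ball_pos)
      have "\<eta> / measure M (ball x r) \<le> measure M (ball x D) / measure M (ball x r)"
        using \<eta>[OF x] m by (simp add: divide_right_mono)
      also have "\<dots> \<le> C * (D / r) powr s" using C[OF x r] .
      finally have "\<eta> \<le> C * (D powr s / r powr s) * measure M (ball x r)"
        using m r \<open>0 < D\<close> by (simp add: pos_divide_le_eq powr_divide)
      then show "K * r powr s \<le> measure M (ball x r)"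
        using r \<open>0 < C\<close> \<open>0 < D\<close> by (simp add: K_def field_simps)
    qed
  qed
  note \<tau> = lower_Lq_spectrum_ge[OF assms(1,2) _ \<open>0 < K\<close> this]
  have "t \<le> s" if t: "\<forall>q<0. lower_Lq_spectrum M q < ereal (t * q)" for t
  proof (rule ccontr)
    assume "\<not> t \<le> s"
    \<comment> \<open>\<open>(q - 1) * s < t * q\<close> says \<open>- s < (t - s) * q\<close>, which fails for every \<open>q \<le> - s / (t - s)\<close>;
      the extra \<open>- 1\<close> makes \<open>q\<close> negative also when \<open>s = 0\<close>.\<close>
    define q where "q = - s / (t - s) - 1"
    have "q < 0" using \<open>\<not> t \<le> s\<close> \<open>0 \<le> s\<close> by (auto simp: q_def field_simps)
    then have "(q - 1) * s < t * q"
      using le_less_trans[OF \<tau>, of q "ereal (t * q)"] t by auto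
    then have "- s < (t - s) * q" by (simp add: algebra_simps)
    also have "\<dots> = - s - (t - s)" using \<open>\<not> t \<le> s\<close> by (simp add: q_def field_simps)
    finally show False using \<open>\<not> t \<le> s\<close> by simp
  qed
  then show "top_of_spectrum M \<le> e"
    unfolding top_of_spectrum_def e using \<open>0 \<le> s\<close> by (intro Sup_least) auto
qed

section \<open>Self-similar measures with strong separation\<close>

locale separated_self_similar_measure =
  fixes I :: "'i set" and X F :: "'a::heine_borel set"
    and S :: "'i \<Rightarrow> 'a \<Rightarrow> 'a" and c p :: "'i \<Rightarrow> real" and M :: "'a measure"
  assumes ifs: "similarity_ifs I X S c"
    and attractor: "is_attractor I X S F"
    and prob_vector: "prob_vector I p"
    and self_similar: "is_self_similar_measure I X S p M"
    and separation: "strong_separation I S F"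
begin

lemma finite_I: "finite I" and compact_X: "compact X"
  and ratio_pos: "\<And>i. i \<in> I \<Longrightarrow> 0 < c i" and ratio_lt1: "\<And>i. i \<in> I \<Longrightarrow> c i < 1"
  and dist_S: "\<And>i x y. i \<in> I \<Longrightarrow> x \<in> X \<Longrightarrow> y \<in> X \<Longrightarrow> dist (S i x) (S i y) = c i * dist x y"
  using ifs by (auto simp: similarity_ifs_def similarity_on_def)

lemma F_subset: "F \<subseteq> X" and compact_F: "compact F" and F_nonempty: "F \<noteq> {}"
  and F_eq: "F = (\<Union>i\<in>I. S i ` F)"
  using attractor unfolding is_attractor_def by blast+

lemma S_in_F: "i \<in> I \<Longrightarrow> x \<in> F \<Longrightarrow> S i x \<in> F"
  using F_eq by blast

lemma F_cases:
  assumes "x \<in> F" obtains i y where "i \<in> I" "y \<in> F" "x = S i y"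
  using assms F_eq by blast

lemma p_pos: "i \<in> I \<Longrightarrow> 0 < p i" and sum_p: "(\<Sum>i\<in>I. p i) = 1"
  using prob_vector by (auto simp: prob_vector_def)

lemma p_le1: "i \<in> I \<Longrightarrow> p i \<le> 1"
  using member_le_sum[of i I p] finite_I p_pos sum_p by (force simp: less_imp_le)

lemma I_nonempty: "I \<noteq> {}"
  using sum_p by auto

lemma sets_M: "sets M = sets borel"
  and self_similar_eq: "\<And>A. A \<in> sets borel \<Longrightarrow> measure M A = (\<Sum>i\<in>I. p i * measure M (S i -` A \<inter> X))"
  using self_similar by (auto simp: is_self_similar_measure_def)

lemma space_M: "space M = UNIV"
  using sets_eq_imp_space_eq[OF sets_M] by simp

sublocale prob_space M
  using self_similar by (intro prob_spaceI) (simp add: is_self_similar_measure_def)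

lemma continuous_S: "i \<in> I \<Longrightarrow> continuous_on X (S i)"
  by (rule continuous_on_subset[OF lipschitz_on_continuous_on[of "c i" X] order_refl])
    (auto intro!: lipschitz_onI simp: dist_S ratio_pos less_imp_le)

lemma preimage_borel:
  assumes "i \<in> I" "A \<in> sets borel"
  shows "S i -` A \<inter> X \<in> sets M"
proof -
  have "S i \<in> borel_measurable (restrict_space borel X)"
    using assms(1) by (intro borel_measurable_continuous_on_restrict continuous_S)
  then have "S i -` A \<inter> space (restrict_space borel X) \<in> sets (restrict_space borel X)"
    using assms(2) by (rule measurable_sets)
  then show ?thesis
    using compact_X by (simp add: space_restrict_space sets_restrict_space_iff borel_compact sets_M)
qed

lemma measure_X: "prob X = 1"
proof -
  have "prob UNIV = (\<Sum>i\<in>I. p i * prob X)"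
    using self_similar_eq[of UNIV] by simp
  also have "\<dots> = prob X"
    by (simp add: sum_distrib_right[symmetric] sum_p)
  finally show ?thesis
    using prob_space by (simp add: space_M)
qed

text \<open>
Since \<open>S i\<close> maps \<open>F\<close> into itself, it brings every point of \<open>X\<close> closer to \<open>F\<close> by the factor \<open>c i\<close>.
\<close>
lemma infdist_S:
  assumes "i \<in> I" "x \<in> X"
  shows "infdist (S i x) F \<le> c i * infdist x F"
proof -
  obtain a where "a \<in> F" "infdist x F = dist x a"
    using infdist_attains_inf[OF compact_imp_closed[OF compact_F] F_nonempty] by blast
  then show ?thesis
    using assms F_subset by (intro infdist_le2[of "S i a"]) (auto simp: S_in_F dist_S)
qed

lemma ratio_bounds:
  obtains a b where "0 < a" "b < 1" "0 < b" "\<And>i. i \<in> I \<Longrightarrow> a \<le> c i" "\<And>i. i \<in> I \<Longrightarrow> c i \<le> b"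
proof
  show "0 < Min (c ` I)" "Max (c ` I) < 1"
    using finite_I I_nonempty ratio_pos ratio_lt1 by auto
  then show "0 < Max (c ` I)"
    using finite_I I_nonempty ratio_pos by (subst Max_gr_iff) auto
qed (use finite_I in auto)

text \<open>
All maps send the \<open>t\<close>-neighbourhood of \<open>F\<close> into its \<open>b * t\<close>-neighbourhood, where \<open>b < 1\<close> bounds all
ratios. By self-similarity the smaller neighbourhood has at least the mass of the larger one. Starting
from \<open>X\<close> itself, which has full mass, all neighbourhoods of \<open>F\<close> have full mass, and so has their
intersection \<open>F\<close>.
\<close>
lemma measure_F: "prob F = 1"
proof -
  obtain b where b: "0 < b" "b < 1" "\<And>i. i \<in> I \<Longrightarrow> c i \<le> b"
    using ratio_bounds by metis
  define V where "V t = {x \<in> X. infdist x F \<le> t}" for t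
  have closed_V: "closed (V t)" for t
  proof -
    have "V t = X \<inter> {x. infdist x F \<le> t}"
      by (auto simp: V_def)
    then show ?thesis
      using compact_imp_closed[OF compact_X]
      by (simp add: closed_Int closed_Collect_le continuous_on_infdist continuous_on_id)
  qed
  then have V_borel: "V t \<in> sets borel" for t
    by simp
  have V_sets: "V t \<in> sets M" for t
    using V_borel sets_M by simp
  have shrink: "prob (V t) \<le> prob (V (b * t))" if "0 \<le> t" for t
  proof -
    have "prob (V t) = (\<Sum>i\<in>I. p i * prob (V t))"
      by (simp add: sum_distrib_right[symmetric] sum_p)
    also have "\<dots> \<le> (\<Sum>i\<in>I. p i * prob (S i -` V (b * t) \<inter> X))"
    proof (intro sum_mono mult_left_mono finite_measure_mono preimage_borel V_borel)
      fix i assume i: "i \<in> I"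
      show "V t \<subseteq> S i -` V (b * t) \<inter> X"
      proof
        fix x assume "x \<in> V t"
        then have x: "x \<in> X" "infdist x F \<le> t" by (auto simp: V_def)
        have "infdist (S i x) F \<le> c i * infdist x F"
          using infdist_S i x by simp
        also have "\<dots> \<le> b * t"
          using b i x by (intro mult_mono) (auto simp: infdist_nonneg)
        moreover have "S i x \<in> X"
          using i x ifs by (auto simp: similarity_ifs_def)
        ultimately show "x \<in> S i -` V (b * t) \<inter> X"
          using x by (simp add: V_def)
      qed
    qed (use p_pos in \<open>auto simp: less_imp_le\<close>)
    also have "\<dots> = prob (V (b * t))"
      by (rule self_similar_eq[OF V_borel, symmetric])
    finally show ?thesis .
  qed
  obtain a where a: "a \<in> F" using F_nonempty by blast
  define t where "t = diameter X"
  have "0 \<le> t"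
    unfolding t_def using compact_X by (simp add: diameter_ge_0 compact_imp_bounded)
  have "infdist x F \<le> t" if "x \<in> X" for x
    unfolding t_def using a F_subset compact_X that
    by (intro infdist_le2[OF a] diameter_bounded_bound compact_imp_bounded) auto
  then have "V t = X"
    by (auto simp: V_def)
  have full: "prob (V (b ^ n * t)) = 1" for n
  proof (induction n)
    case 0
    then show ?case by (simp add: \<open>V t = X\<close> measure_X)
  next
    case (Suc n)
    then have "1 \<le> prob (V (b ^ Suc n * t))"
      using shrink[of "b ^ n * t"] b \<open>0 \<le> t\<close> by (simp add: mult.assoc)
    then show ?case
      using prob_le_1 by (rule antisym[rotated])
  qed
  have lim: "(\<lambda>n. b ^ n * t) \<longlonglongrightarrow> 0"
    using b by (intro tendsto_mult_left_zero LIMSEQ_power_zero) auto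
  have "F = (\<Inter>n. V (b ^ n * t))"
  proof (intro equalityI subsetI)
    fix x assume "x \<in> F"
    then show "x \<in> (\<Inter>n. V (b ^ n * t))"
      using F_subset b \<open>0 \<le> t\<close> by (auto simp: V_def)
  next
    fix x assume "x \<in> (\<Inter>n. V (b ^ n * t))"
    then have "infdist x F \<le> b ^ n * t" for n by (auto simp: V_def)
    then have "infdist x F \<le> 0"
      by (intro LIMSEQ_le_const[OF lim]) auto
    then show "x \<in> F"
      using in_closed_iff_infdist_zero[OF compact_imp_closed[OF compact_F] F_nonempty]
        infdist_nonneg[of x F] by (metis order_antisym)
  qed
  moreover have "prob (\<Inter>n. V (b ^ n * t)) = 1"
  proof -
    have "AE x in M. x \<in> V (b ^ n * t)" for n
      using full V_sets by (intro AE_in_set_eq_1[THEN iffD2]) auto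
    then have "AE x in M. x \<in> (\<Inter>n. V (b ^ n * t))"
      by (simp add: AE_all_countable)
    then show ?thesis
      using V_sets by (subst (asm) AE_in_set_eq_1) auto
  qed
  ultimately show ?thesis by simp
qed

lemma sets_F: "F \<in> sets M"
  by (simp add: sets_M borel_compact compact_F)

lemma measure_Int_F:
  assumes "A \<in> sets M"
  shows "prob (A \<inter> F) = prob A"
proof -
  have "AE x in M. x \<in> F"
    using measure_F sets_F by (simp add: AE_in_set_eq_1)
  then show ?thesis
    using assms sets_F by (intro finite_measure_eq_AE) auto
qed

subsection \<open>Renormalisation of balls\<close>

lemma measure_ball_eq_sum:
  "prob (ball x r) = (\<Sum>i\<in>I. p i * prob {y \<in> F. dist x (S i y) < r})"
proof -
  have "prob (ball x r) = (\<Sum>i\<in>I. p i * prob (S i -` ball x r \<inter> X))"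
    by (rule self_similar_eq) simp
  also have "\<dots> = (\<Sum>i\<in>I. p i * prob {y \<in> F. dist x (S i y) < r})"
  proof (intro sum.cong refl arg_cong2[where f = "(*)"])
    fix i assume "i \<in> I"
    then have "prob (S i -` ball x r \<inter> X) = prob (S i -` ball x r \<inter> X \<inter> F)"
      by (intro measure_Int_F[symmetric] preimage_borel) auto
    also have "S i -` ball x r \<inter> X \<inter> F = {y \<in> F. dist x (S i y) < r}"
      using F_subset by auto
    finally show "prob (S i -` ball x r \<inter> X) = prob {y \<in> F. dist x (S i y) < r}" .
  qed
  finally show ?thesis .
qed

lemma measure_piece_of_ball:
  assumes "i \<in> I" "y \<in> F"
  shows "prob {z \<in> F. dist (S i y) (S i z) < r} = prob (ball y (r / c i))"
proof -
  have "{z \<in> F. dist (S i y) (S i z) < r} = ball y (r / c i) \<inter> F"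
    using assms F_subset ratio_pos by (auto simp: dist_S pos_less_divide_eq mult.commute subset_iff)
  then show ?thesis
    by (simp add: measure_Int_F sets_M)
qed

lemma measure_ball_ge:
  assumes "i \<in> I" "y \<in> F"
  shows "p i * prob (ball y (r / c i)) \<le> prob (ball (S i y) r)"
proof -
  have "p i * prob {z \<in> F. dist (S i y) (S i z) < r}
      \<le> (\<Sum>j\<in>I. p j * prob {z \<in> F. dist (S i y) (S j z) < r})"
    using assms finite_I p_pos
    by (intro member_le_sum[where f = "\<lambda>j. p j * prob {z \<in> F. dist (S i y) (S j z) < r}"])
      (simp_all add: less_imp_le)
  then show ?thesis
    using assms by (simp add: measure_ball_eq_sum[of "S i y"] measure_piece_of_ball)
qed

definition separated_by :: "real \<Rightarrow> bool" where
  "separated_by \<delta> \<longleftrightarrow> (\<forall>i\<in>I. \<forall>j\<in>I. i \<noteq> j \<longrightarrow> (\<forall>x\<in>F. \<forall>y\<in>F. \<delta> \<le> dist (S i x) (S j y)))"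

lemma separated_by_exists: "\<exists>\<delta>>0. separated_by \<delta>"
proof -
  have compact_piece: "compact (S i ` F)" if "i \<in> I" for i
    by (rule compact_continuous_image[OF continuous_on_subset[OF continuous_S[OF that] F_subset] compact_F])
  have "\<forall>\<^sub>F \<delta> in at_right 0. i \<noteq> j \<longrightarrow> (\<forall>x\<in>F. \<forall>y\<in>F. \<delta> \<le> dist (S i x) (S j y))"
    if ij: "i \<in> I" "j \<in> I" for i j
  proof (cases "i = j")
    case False
    then have "S i ` F \<inter> S j ` F = {}"
      using ij separation by (simp add: strong_separation_def)
    then obtain d where "0 < d" and d: "\<forall>x\<in>S i ` F. \<forall>y\<in>S j ` F. d \<le> dist x y"
      using separate_compact_closed[OF compact_piece[OF ij(1)] compact_imp_closed[OF compact_piece[OF ij(2)]]]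
      by blast
    from eventually_at_right_real[OF \<open>0 < d\<close>] show ?thesis
    proof eventually_elim
      case (elim \<delta>)
      then have "\<delta> \<le> d" by simp
      with d show ?case by (meson imageI order_trans)
    qed
  qed simp
  then have "\<forall>\<^sub>F \<delta> in at_right 0. separated_by \<delta>"
    unfolding separated_by_def by (intro eventually_ball_finite[OF finite_I] ballI)
  then have "\<forall>\<^sub>F \<delta> in at_right 0. 0 < \<delta> \<and> separated_by \<delta>"
    by (intro eventually_conj eventually_at_right_less)
  then show ?thesis
    using eventually_happens'[OF trivial_limit_at_right_real] by blast
qed

text \<open>
A ball of radius at most \<open>\<delta>\<close> centred in one piece of \<open>F\<close> misses all the other pieces, so only one
term of \<open>measure_ball_eq_sum\<close> survives.
\<close>
lemma measure_ball_eq: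
  assumes "separated_by \<delta>" "r \<le> \<delta>" "i \<in> I" "y \<in> F"
  shows "prob (ball (S i y) r) = p i * prob (ball y (r / c i))"
proof -
  have "prob (ball (S i y) r) = (\<Sum>j\<in>I. p j * prob {z \<in> F. dist (S i y) (S j z) < r})"
    by (rule measure_ball_eq_sum)
  also have "\<dots> = (\<Sum>j\<in>{i}. p j * prob {z \<in> F. dist (S i y) (S j z) < r})"
  proof (intro sum.mono_neutral_right ballI finite_I)
    fix j assume "j \<in> I - {i}"
    then have "\<delta> \<le> dist (S i y) (S j z)" if "z \<in> F" for z
      using assms that by (auto simp: separated_by_def)
    then have empty: "{z \<in> F. dist (S i y) (S j z) < r} = {}"
      using assms(2) by fastforce
    then show "p j * prob {z \<in> F. dist (S i y) (S j z) < r} = 0"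
      by (simp only: empty measure_empty mult_zero_right)
  qed (use assms in auto)
  also have "\<dots> = p i * prob (ball y (r / c i))"
    using assms by (simp add: measure_piece_of_ball)
  finally show ?thesis .
qed

subsection \<open>The extremal exponent\<close>

definition s_max :: real where
  "s_max = Max ((\<lambda>i. ln (p i) / ln (c i)) ` I)"

lemma ratio_powr_le:
  assumes "i \<in> I"
  shows "c i powr s_max \<le> p i"
proof -
  have "ln (p i) / ln (c i) \<le> s_max"
    using assms finite_I by (simp add: s_max_def)
  then have "s_max * ln (c i) \<le> ln (p i)"
    using ratio_pos ratio_lt1 assms by (simp add: neg_divide_le_eq)
  then have "exp (s_max * ln (c i)) \<le> exp (ln (p i))"
    by simp
  then show ?thesis
    using ratio_pos[OF assms] p_pos[OF assms] by (simp add: powr_def)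
qed

lemma ratio_powr_eq: "\<exists>i\<in>I. p i = c i powr s_max"
proof -
  have "s_max \<in> (\<lambda>i. ln (p i) / ln (c i)) ` I"
    unfolding s_max_def using finite_I I_nonempty by (intro Max_in) auto
  then obtain i where i: "i \<in> I" "s_max = ln (p i) / ln (c i)"
    by blast
  then show ?thesis
    using ratio_pos[of i] ratio_lt1[of i] p_pos[of i] by (intro bexI[of _ i]) (simp_all add: powr_def)
qed

lemma s_max_nonneg: "0 \<le> s_max"
proof -
  obtain i where i: "i \<in> I" using I_nonempty by auto
  then have "0 \<le> ln (p i) / ln (c i)"
    using ratio_pos[of i] ratio_lt1[of i] p_pos[of i] p_le1[of i] by (simp add: divide_nonpos_neg)
  also have "\<dots> \<le> s_max"
    using i finite_I by (simp add: s_max_def)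
  finally show ?thesis .
qed

text \<open>
Induction on scales: every point of \<open>F\<close> is of the form \<open>S i y\<close>, and passing from \<open>(S i y, r)\<close> to
\<open>(y, r / c i)\<close> enlarges the radius by a factor bounded away from 1, so that after finitely many steps the
radius is at least \<open>r0\<close>.
\<close>
lemma scale_induct [consumes 3, case_names large small]:
  assumes "x \<in> F" "0 < r" "0 < r0"
    and large: "\<And>x r. x \<in> F \<Longrightarrow> r0 \<le> r \<Longrightarrow> P x r"
    and small: "\<And>i y r. i \<in> I \<Longrightarrow> y \<in> F \<Longrightarrow> 0 < r \<Longrightarrow> r < r0 \<Longrightarrow> P y (r / c i) \<Longrightarrow> P (S i y) r"
  shows "P x r"
proof -
  obtain b where b: "0 < b" "b < 1" "\<And>i. i \<in> I \<Longrightarrow> c i \<le> b"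
    using ratio_bounds by metis
  have *: "P x r" if "x \<in> F" "0 < r" "r0 * b ^ n \<le> r" for x r n
    using that
  proof (induction n arbitrary: x r)
    case 0
    then show ?case using large by simp
  next
    case (Suc n)
    show ?case
    proof (cases "r0 \<le> r")
      case False
      obtain i y where i: "i \<in> I" "y \<in> F" "x = S i y"
        using Suc.prems F_cases by blast
      have "r0 * b ^ n \<le> r / b"
        using Suc.prems b by (simp add: pos_le_divide_eq mult_ac)
      also have "\<dots> \<le> r / c i"
        using Suc.prems b i ratio_pos by (intro divide_left_mono) auto
      finally have "P y (r / c i)"
        using Suc i ratio_pos by (intro Suc.IH) auto
      then show ?thesis
        using small[of i y r] i Suc.prems False by simp
    qed (use large Suc.prems in auto)
  qed
  have "(\<lambda>n. r0 * b ^ n) \<longlonglongrightarrow> 0"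
    using b by (intro tendsto_mult_right_zero LIMSEQ_power_zero) auto
  then have "\<forall>\<^sub>F n in sequentially. r0 * b ^ n < r"
    using \<open>0 < r\<close> by (rule order_tendstoD)
  then obtain n where "r0 * b ^ n < r"
    using eventually_happens'[OF sequentially_bot] by blast
  then show ?thesis
    using *[of x r n] assms by simp
qed

subsection \<open>Lower bounds for the mass of balls\<close>

lemma measure_ball_large:
  assumes "x \<in> F" "diameter F < r"
  shows "prob (ball x r) = 1"
proof -
  have "F \<subseteq> ball x r"
    using assms compact_F diameter_bounded_bound[OF compact_imp_bounded, of F x]
    by (force simp: mem_ball)
  then have "prob F \<le> prob (ball x r)"
    by (intro finite_measure_mono) (auto simp: sets_M)
  then show ?thesis
    using measure_F prob_le_1[of "ball x r"] by linarith
qed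

text \<open>
Each renormalisation step costs a factor \<open>p i \<ge> c i powr s_max\<close> and gains the radius factor \<open>1 / c i\<close>,
so the power law is preserved. The constant is chosen so that the right range of radii is left
invariant: the step from a radius below \<open>D\<close> ends below \<open>D / a\<close>, and between \<open>D\<close> and \<open>D / a\<close> the ball
has full mass while the claimed bound is at most 1.
\<close>
lemma measure_ball_lower_bound:
  assumes D: "diameter F < D" "0 < D" and a: "0 < a" "\<And>i. i \<in> I \<Longrightarrow> a \<le> c i"
    and "x \<in> F" "0 < r" "r \<le> D / a"
  shows "(r * a / D) powr s_max \<le> prob (ball x r)"
  using \<open>x \<in> F\<close> \<open>0 < r\<close> \<open>0 < D\<close> \<open>r \<le> D / a\<close>
proof (induction x r rule: scale_induct)
  case (large x r)
  then have "r * a / D \<le> 1"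
    using D a by (simp add: field_simps)
  then have "(r * a / D) powr s_max \<le> 1"
    using D a large s_max_nonneg by (intro powr_le1) auto
  then show ?case
    using measure_ball_large[of x r] large D by simp
next
  case (small i y r)
  have c: "0 < c i" "a \<le> c i" using small a ratio_pos by auto
  have "r / c i \<le> D / c i" using small c by (simp add: divide_right_mono)
  also have "\<dots> \<le> D / a" using c a D by (intro divide_left_mono) auto
  finally have IH: "(r / c i * a / D) powr s_max \<le> prob (ball y (r / c i))"
    using small by simp
  have "(r * a / D) powr s_max = (c i * (r / c i * a / D)) powr s_max"
    using c by simp
  also have "\<dots> = c i powr s_max * (r / c i * a / D) powr s_max"
    using c a small D by (intro powr_mult)
  also have "\<dots> \<le> p i * prob (ball y (r / c i))"
    using IH ratio_powr_le[of i] small p_pos[of i] by (intro mult_mono) auto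
  also have "\<dots> \<le> prob (ball (S i y) r)"
    using small by (intro measure_ball_ge)
  finally show ?case .
qed

text \<open>
Points off the closed set \<open>F\<close> have a neighbourhood disjoint from this set of full mass; on \<open>F\<close> the
power law gives positive mass to all balls.
\<close>
lemma msupp_eq: "msupp M = F"
proof (intro equalityI subsetI)
  fix x assume x: "x \<in> msupp M"
  show "x \<in> F"
  proof (rule ccontr)
    assume "x \<notin> F"
    then obtain r where r: "0 < r" "ball x r \<subseteq> - F"
      using openE[OF open_Compl[OF compact_imp_closed[OF compact_F]], of x] by auto
    then have "ball x r \<inter> F = {}"
      by blast
    then have "prob (ball x r) = 0"
      using measure_Int_F[of "ball x r"] by (simp add: sets_M)
    then show False
      using measure_ball_pos[OF prob_space_axioms x r(1)] by simp
  qed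
next
  fix x assume x: "x \<in> F"
  obtain a where a: "0 < a" "\<And>i. i \<in> I \<Longrightarrow> a \<le> c i"
    using ratio_bounds by metis
  define D where "D = diameter F + 1"
  have D: "diameter F < D" "0 < D"
    using diameter_ge_0[OF compact_imp_bounded[OF compact_F]] by (auto simp: D_def)
  have "0 < prob (ball x r)" if "0 < r" for r
  proof -
    define t where "t = min r (D / a)"
    have t: "0 < t" "t \<le> r" "t \<le> D / a"
      using that D a by (auto simp: t_def)
    have "0 < (t * a / D) powr s_max"
      using t D a by simp
    also have "\<dots> \<le> prob (ball x t)"
      using measure_ball_lower_bound[OF D a x] t by simp
    also have "\<dots> \<le> prob (ball x r)"
      using t by (intro finite_measure_mono subset_ball) (auto simp: sets_M)
    finally show ?thesis .
  qed
  then show "x \<in> msupp M"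
    by (simp add: msupp_def emeasure_eq_measure)
qed

text \<open>
As long as \<open>R \<le> \<delta>\<close>, both balls are rescaled exactly and with the same factors \<open>p i\<close> and \<open>c i\<close>, which
leaves the inequality unchanged. So only \<open>R \<ge> \<delta>\<close> needs an argument, and there the absolute lower bound
for the mass of the smaller ball suffices.
\<close>
lemma measure_ball_ratio:
  "\<exists>C>0. \<forall>R. \<forall>x\<in>F. \<forall>r. 0 < r \<and> r < R \<longrightarrow>
    prob (ball x R) \<le> C * (R / r) powr s_max * prob (ball x r)"
proof -
  obtain a where a: "0 < a" "\<And>i. i \<in> I \<Longrightarrow> a \<le> c i"
    using ratio_bounds by metis
  define D where "D = diameter F + 1"
  have D: "diameter F < D" "0 < D"
    using diameter_ge_0[OF compact_imp_bounded[OF compact_F]] by (auto simp: D_def)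
  obtain \<delta> where \<delta>: "0 < \<delta>" "separated_by \<delta>"
    using separated_by_exists by blast
  define C where "C = max 1 ((D / (a * \<delta>)) powr s_max)"
  have C: "1 \<le> C" "(D / (a * \<delta>)) powr s_max \<le> C"
    by (auto simp: C_def)
  have "prob (ball x R) \<le> C * (R / r) powr s_max * prob (ball x r)"
    if "x \<in> F" "0 < R" "0 < r" "r < R" for x r R
    using \<open>x \<in> F\<close> \<open>0 < R\<close> \<open>0 < \<delta>\<close> \<open>0 < r\<close> \<open>r < R\<close>
  proof (induction x R arbitrary: r rule: scale_induct)
    case (large x R)
    have "1 \<le> C * (R / r) powr s_max * prob (ball x r)"
    proof (cases "r \<le> D / a")
      case True
      \<comment> \<open>The product of the three bases is 1; the factors are bounded separately by \<open>C\<close>, by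
        \<open>\<delta> \<le> R\<close>, and by the lower bound for the mass.\<close>
      have "1 = (D / (a * \<delta>)) powr s_max * (\<delta> / r) powr s_max * (r * a / D) powr s_max"
        using D a \<delta> large by (simp add: powr_mult[symmetric])
      also have "\<dots> \<le> C * (R / r) powr s_max * prob (ball x r)"
        using measure_ball_lower_bound[OF D a large(1) large(3) True] C large \<delta> s_max_nonneg
        by (intro mult_mono powr_mono2 divide_right_mono mult_nonneg_nonneg) auto
      finally show ?thesis .
    next
      case False
      have "D \<le> D / a"
        using D a I_nonempty ratio_lt1 by (force simp: pos_le_divide_eq)
      then have "prob (ball x r) = 1"
        using False D large by (intro measure_ball_large) auto
      moreover have "1 \<le> (R / r) powr s_max"
        using large s_max_nonneg by (intro ge_one_powr_ge_zero) auto
      ultimately show ?thesis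
        using C(1) mult_mono[of 1 C 1 "(R / r) powr s_max"] by simp
    qed
    then show ?case
      using prob_le_1 order_trans by blast
  next
    case (small i y R)
    have c: "0 < c i" using small ratio_pos by auto
    have "prob (ball y (R / c i)) \<le> C * ((R / c i) / (r / c i)) powr s_max * prob (ball y (r / c i))"
      using small c by (intro small.IH) (auto simp: divide_strict_right_mono)
    then have "p i * prob (ball y (R / c i))
        \<le> C * (R / r) powr s_max * (p i * prob (ball y (r / c i)))"
      using c p_pos[of i] small by (simp add: mult.left_commute)
    then show ?case
      using small \<delta> by (simp add: measure_ball_eq[where \<delta> = \<delta>])
  qed
  then show ?thesis
    using C(1) by (intro exI[of _ C]) auto
qed

subsection \<open>Bounds for the dimensions\<close>

lemma upper_reg_dim_le: "upper_reg_dim M \<le> ereal s_max"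
proof -
  obtain C where "0 < C" and C: "\<And>x r R. x \<in> F \<Longrightarrow> 0 < r \<Longrightarrow> r < R \<Longrightarrow>
      prob (ball x R) \<le> C * (R / r) powr s_max * prob (ball x r)"
    using measure_ball_ratio by blast
  have "prob (ball x R) / prob (ball x r) \<le> C * (R / r) powr s_max"
    if "x \<in> msupp M" "0 < r" "r < R" for x r R
    using C[of x r R] that measure_ball_pos[OF prob_space_axioms that(1,2)]
    by (simp add: msupp_eq pos_divide_le_eq)
  then show ?thesis
    unfolding upper_reg_dim_def using s_max_nonneg \<open>0 < C\<close> by (intro Inf_lower) blast
qed

text \<open>
At the fixed point of a map \<open>S i\<close> with \<open>p i = c i powr s_max\<close> the renormalisation reproduces the same
centre, and each step multiplies the mass by exactly \<open>c i powr s_max\<close>. The radius is measured in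
units of \<open>\<delta>\<close>, and the bound is at least 1 until the radius drops below \<open>\<delta> * c i\<close>.
\<close>
lemma measure_ball_fixed_point_le:
  assumes i: "i \<in> I" "p i = c i powr s_max" and x: "x \<in> F" "S i x = x"
  shows "\<exists>K>0. \<forall>r>0. prob (ball x r) \<le> K * r powr s_max"
proof -
  have c: "0 < c i" "c i < 1" using i ratio_pos ratio_lt1 by auto
  obtain \<delta> where \<delta>: "0 < \<delta>" "separated_by \<delta>"
    using separated_by_exists by blast
  have upper: "prob (ball x (\<delta> * t)) \<le> (t / c i) powr s_max" if "c i ^ n \<le> t" "0 < t" for t n
    using that
  proof (induction n arbitrary: t)
    case 0
    then have "1 \<le> t / c i" using c by (simp add: pos_le_divide_eq)
    then have "1 \<le> (t / c i) powr s_max"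
      using s_max_nonneg by (intro ge_one_powr_ge_zero) auto
    then show ?case using prob_le_1 order_trans by blast
  next
    case (Suc n)
    show ?case
    proof (cases "t \<le> 1")
      case True
      have "prob (ball x (\<delta> * t)) = p i * prob (ball x (\<delta> * (t / c i)))"
        using measure_ball_eq[OF \<delta>(2), of "\<delta> * t" i x] True \<delta> i x by simp
      also have "\<dots> \<le> p i * (t / c i / c i) powr s_max"
        using Suc c i p_pos[of i] by (intro mult_left_mono Suc.IH) (auto simp: field_simps)
      also have "\<dots> = (c i * (t / c i / c i)) powr s_max"
        using Suc c i by (subst powr_mult) auto
      finally show ?thesis using c by simp
    next
      case False
      then have "1 \<le> t / c i" using c by (simp add: pos_le_divide_eq)
      then have "1 \<le> (t / c i) powr s_max"
        using s_max_nonneg by (intro ge_one_powr_ge_zero) auto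
      then show ?thesis using prob_le_1 order_trans by blast
    qed
  qed
  define K where "K = (1 / (\<delta> * c i)) powr s_max"
  have "0 < K" using \<delta> c by (simp add: K_def)
  have bound: "prob (ball x r) \<le> K * r powr s_max" if "0 < r" for r
  proof -
    have "\<forall>\<^sub>F n in sequentially. c i ^ n < r / \<delta>"
      using LIMSEQ_power_zero[of "c i"] c that \<delta> by (intro order_tendstoD) auto
    then obtain n where n: "c i ^ n < r / \<delta>"
      using eventually_happens'[OF sequentially_bot] by blast
    then have "prob (ball x r) \<le> (r / \<delta> / c i) powr s_max"
      using upper[of n "r / \<delta>"] that \<delta> by simp
    also have "\<dots> = K * r powr s_max"
      using that \<delta> c by (simp add: K_def powr_mult[symmetric])
    finally show ?thesis .
  qed
  then show ?thesis
    using \<open>0 < K\<close> by blast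
qed

lemma s_max_le_upper_loc_dim: "\<exists>x\<in>F. ereal s_max \<le> upper_loc_dim M x"
proof -
  obtain i where i: "i \<in> I" "p i = c i powr s_max"
    using ratio_powr_eq by blast
  have c: "0 < c i" "c i < 1" using i ratio_pos ratio_lt1 by auto
  have "\<exists>!x. x \<in> F \<and> S i x = x"
    using i c compact_F F_nonempty F_subset
    by (intro Banach_fix[of F "c i"]) (auto simp: S_in_F dist_S compact_imp_complete subset_iff)
  then obtain x where x: "x \<in> F" "S i x = x" by blast
  obtain K where "0 < K" and bound: "\<And>r. 0 < r \<Longrightarrow> prob (ball x r) \<le> K * r powr s_max"
    using measure_ball_fixed_point_le[OF i x] by blast
  have "((\<lambda>r. ereal (ln (K * r powr s_max) / ln r)) \<longlongrightarrow> ereal s_max) (at_right 0)"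
    using tendsto_log_of_power_law[OF \<open>0 < K\<close>] by simp
  then have "ereal s_max = Limsup (at_right 0) (\<lambda>r. ereal (ln (K * r powr s_max) / ln r))"
    by (intro lim_imp_Limsup[symmetric]) auto
  also have "\<dots> \<le> upper_loc_dim M x"
    unfolding upper_loc_dim_def
  proof (rule Limsup_mono, use eventually_at_right_real[of 0 1, simplified] in eventually_elim)
    case (elim r)
    then have r: "0 < r" "ln r < 0" by auto
    have "0 < prob (ball x r)"
      using measure_ball_pos[OF prob_space_axioms _ r(1)] x by (simp add: msupp_eq)
    then have "ln (prob (ball x r)) \<le> ln (K * r powr s_max)"
      using bound[OF r(1)] by simp
    then show ?case
      using r by (simp add: divide_right_mono_neg)
  qed
  finally show ?thesis using x by blast
qed

end

section \<open>Equality of the dimensions\<close>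

theorem theorem2p4:
  fixes I :: "'i set"
    and X F :: "'a::euclidean_space set"
    and S :: "'i \<Rightarrow> 'a \<Rightarrow> 'a"
    and c p :: "'i \<Rightarrow> real"
    and \<mu> :: "'a measure"
  assumes "similarity_ifs I X S c"
    and "is_attractor I X S F"
    and "prob_vector I p"
    and "is_self_similar_measure I X S p \<mu>"
    and "strong_separation I S F"
  shows "upper_reg_dim \<mu> = (SUP x\<in>msupp \<mu>. upper_loc_dim \<mu> x)
    \<and> (SUP x\<in>msupp \<mu>. upper_loc_dim \<mu> x) = top_of_spectrum \<mu>
    \<and> top_of_spectrum \<mu> = ereal (Max ((\<lambda>i. ln (p i) / ln (c i)) ` I))"
proof -
  interpret separated_self_similar_measure I X F S c p \<mu>
    using assms by unfold_locales
  let ?loc = "SUP x\<in>msupp \<mu>. upper_loc_dim \<mu> x"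
  have "ereal s_max \<le> ?loc"
    using s_max_le_upper_loc_dim by (auto simp: msupp_eq intro: SUP_upper2)
  moreover have "?loc \<le> top_of_spectrum \<mu>"
    using upper_loc_dim_le_top_of_spectrum[OF prob_space_axioms] by (intro SUP_least)
  moreover have "top_of_spectrum \<mu> \<le> upper_reg_dim \<mu>"
  proof (rule top_of_spectrum_le_upper_reg_dim[OF prob_space_axioms sets_M])
    show "0 < diameter F + 1"
      using diameter_ge_0[OF compact_imp_bounded[OF compact_F]] by simp
    show "1 \<le> measure \<mu> (ball x (diameter F + 1))" if "x \<in> msupp \<mu>" for x
      using measure_ball_large[of x] that by (simp add: msupp_eq)
  qed simp
  moreover have "upper_reg_dim \<mu> \<le> ereal s_max"
    by (rule upper_reg_dim_le)
  ultimately have "upper_reg_dim \<mu> = ereal s_max" "?loc = ereal s_max" "top_of_spectrum \<mu> = ereal s_max"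
    by (meson order_trans antisym)+
  then show ?thesis
    by (simp add: s_max_def)
qed

end
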